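(* For every positive integer $k$, the limit $\lim_{n\to\infty}\frac{\tilde{r}(P_k,P_n)}{n}$ exists (as a finite real number).
   Context: For finite graphs $G$ and $H$, the online Ramsey game is played by Builder and Painter on the infinite complete graph $K_{\mathbb{N}}$ with vertex set $\mathbb{N}$. In each round Builder chooses an edge of $K_{\mathbb{N}}$ and Painter immediately and irrevocably colors it red or blue. (Builder may re-choose an already chosen edge, which keeps its color; this gives Builder no advantage.) The online Ramsey number $\tilde{r}(G,H)$ is the smallest integer $t$ for which Builder has a strategy that guarantees, regardless of Painter's choices, a red copy of $G$ or a blue copy of $H$ (as a not necessarily induced subgraph) within at most $t$ rounds. $P_n$ denotes the path on $n$ vertices. *)

theory Defs
  imports Complex_Main
begin

record 'a graph =
  verts :: "'a set"
  edges :: "'a set set"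

definition path_graph :: "nat \<Rightarrow> nat graph" where
  "path_graph n = \<lparr>verts = {..<n}, edges = {{i, Suc i} | i. Suc i < n}\<rparr>"

definition complete_nat :: "nat graph" where
  "complete_nat = \<lparr>verts = UNIV, edges = {{u, v} | u v. u \<noteq> v}\<rparr>"

datatype color = Red | Blue

text \<open>The rounds played so far, most recent first: the edge chosen and its color.\<close>

type_synonym history = "(nat set \<times> color) list"

definition has_copy :: "color \<Rightarrow> 'a graph \<Rightarrow> history \<Rightarrow> bool" where
  "has_copy c G h \<longleftrightarrow>
     (\<exists>f. inj_on f (verts G) \<and> f ` verts G \<subseteq> verts complete_nat \<and>
          (\<forall>e \<in> edges G. (f ` e, c) \<in> set h))"

type_synonym builder = "history \<Rightarrow> nat set"

type_synonym painter = "history \<Rightarrow> nat set \<Rightarrow> color"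

definition legal_builder :: "builder \<Rightarrow> bool" where
  "legal_builder \<sigma> \<longleftrightarrow> (\<forall>h. \<sigma> h \<in> edges complete_nat)"

text \<open>An edge that is chosen again keeps its color; Painter's strategy is only consulted
  on edges not chosen before.\<close>

definition edge_color :: "painter \<Rightarrow> history \<Rightarrow> nat set \<Rightarrow> color" where
  "edge_color \<pi> h e = (case map_of h e of Some c \<Rightarrow> c | None \<Rightarrow> \<pi> h e)"

fun play :: "builder \<Rightarrow> painter \<Rightarrow> nat \<Rightarrow> history" where
  "play \<sigma> \<pi> 0 = []"
| "play \<sigma> \<pi> (Suc t) =
     (let h = play \<sigma> \<pi> t; e = \<sigma> h in (e, edge_color \<pi> h e) # h)"

definition builder_wins_within :: "'a graph \<Rightarrow> 'b graph \<Rightarrow> nat \<Rightarrow> bool" where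
  "builder_wins_within G H t \<longleftrightarrow>
     (\<exists>\<sigma>. legal_builder \<sigma> \<and>
       (\<forall>\<pi>. \<exists>s\<le>t. has_copy Red G (play \<sigma> \<pi> s) \<or> has_copy Blue H (play \<sigma> \<pi> s)))"

text \<open>For finite graphs the minimum exists by Ramsey's theorem; in general \<^const>\<open>Least\<close>
  is unspecified if Builder cannot win within any fixed number of rounds.\<close>

definition online_ramsey :: "'a graph \<Rightarrow> 'b graph \<Rightarrow> nat" where
  "online_ramsey G H = (LEAST t. builder_wins_within G H t)"

end

theory Submission
  imports Defs "HOL-Library.Ramsey"
begin

text \<open>
  Write \<open>r n\<close> for the online Ramsey number of a red path on \<open>k\<close> vertices against a blue path
  on \<open>n\<close> vertices. The limit exists because \<open>r\<close> is subadditive up to constants depending on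
  \<open>k\<close> only:
  \<open>r (a + b + 2 * k) \<le> r (a + 2 * k) + r (b + 2 * k) + k * k\<close>.

  To see this, Builder plays an optimal strategy for a blue path on \<open>a + 2 * k\<close> vertices using
  only even vertices, and then one for a blue path on \<open>b + 2 * k\<close> vertices using only odd
  vertices. Unless a red path on \<open>k\<close> vertices has appeared, this yields two disjoint blue paths.
  Builder now plays all \<open>k * k\<close> edges between the last \<open>k\<close> vertices of the first path and the
  first \<open>k\<close> vertices of the second. If all of them are red, they form a complete bipartite graph
  containing a red path on \<open>2 * k\<close> vertices. Otherwise a blue one joins the two paths, and at
  most \<open>k - 1\<close> vertices of each path are cut off (\<open>forces_path_add\<close>).

  Hence \<open>s n = r (n + 2 * k) + k * k\<close> is subadditive in the exact sense, \<open>s n / n\<close> converges by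
  Fekete's lemma, and \<open>r n / n\<close> has the same limit since the shift and the additive constant are
  negligible. Ramsey's theorem ensures that \<open>r n\<close> is attained by an actual strategy
  (\<open>builder_wins_path_ex\<close>).

  Strategies that are functions of the history are awkward to run one after the other, so the game is
  first recast as an inductive predicate on positions, \<open>forces\<close>, for which playing in succession
  is mere transitivity (\<open>forces_trans\<close>).
\<close>

section \<open>The game as a recursion on positions\<close>

text \<open>
  From position \<open>h\<close>, Builder can reach a position satisfying \<open>Q\<close> within \<open>t\<close> further rounds.
  The premise on \<open>map_of h e\<close> makes Painter free on new edges and bound by the old color on
  repeated ones.
\<close>

inductive forces :: "(history \<Rightarrow> bool) \<Rightarrow> nat \<Rightarrow> history \<Rightarrow> bool" for Q where
  reached: "Q h \<Longrightarrow> forces Q t h"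
| move: "e \<in> edges complete_nat \<Longrightarrow>
    (\<And>c. map_of h e \<in> {None, Some c} \<Longrightarrow> forces Q t ((e, c) # h)) \<Longrightarrow>
    forces Q (Suc t) h"

lemma length_play [simp]: "length (play \<sigma> \<pi> t) = t"
  by (induction t) (auto simp: Let_def)

lemma set_play_mono: "s \<le> t \<Longrightarrow> set (play \<sigma> \<pi> s) \<subseteq> set (play \<sigma> \<pi> t)"
  by (induction t) (auto simp: Let_def le_Suc_eq)

lemma has_copy_mono: "has_copy c G h \<Longrightarrow> set h \<subseteq> set h' \<Longrightarrow> has_copy c G h'"
  unfolding has_copy_def by (meson subsetD)

text \<open>
  Painter's answer at a position \<open>h\<close> cannot influence how the play arrived there: positions
  grow by one in every round, so \<open>h\<close> is not met in the first \<open>length h\<close> rounds.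
\<close>

lemma play_painter_upd:
  "s \<le> length h \<Longrightarrow> play \<sigma> (\<pi>(h := p)) s = play \<sigma> \<pi> s"
proof (induction s)
  case (Suc s)
  then have "play \<sigma> \<pi> s \<noteq> h" by (metis Suc_n_not_le_n length_play)
  with Suc show ?case
    by (auto simp: Let_def edge_color_def split: option.splits)
qed simp

text \<open>
  Every position reached when Builder follows \<open>\<sigma>\<close> is winning within the remaining rounds,
  by induction on their number. Each answer that Painter may give at such a position is the answer
  of some painter reaching the same position, namely of \<open>\<pi>\<close> altered there, so the induction
  hypothesis covers all successors. The goal must persist because a win may come before
  round \<open>t\<close>.
\<close>

lemma strategy_imp_forces:
  assumes legal: "legal_builder \<sigma>"
    and win: "\<And>\<pi>. \<exists>s\<le>t. Q (play \<sigma> \<pi> s)"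
    and mono: "\<And>h h'. Q h \<Longrightarrow> set h \<subseteq> set h' \<Longrightarrow> Q h'"
  shows "forces Q t []"
proof -
  have "forces Q d (play \<sigma> \<pi> s)" if "d + s = t" for d s \<pi>
    using that
  proof (induction d arbitrary: s \<pi>)
    case 0
    then show ?case
      by (metis add_0 forces.reached mono set_play_mono win)
  next
    case (Suc d)
    define h where "h = play \<sigma> \<pi> s"
    have "forces Q d ((\<sigma> h, c) # h)" if c: "map_of h (\<sigma> h) \<in> {None, Some c}" for c
    proof -
      define \<pi>' where "\<pi>' = \<pi>(h := (\<lambda>_. c))"
      have "play \<sigma> \<pi>' s = h"
        unfolding \<pi>'_def h_def by (rule play_painter_upd) simp
      then have "play \<sigma> \<pi>' (Suc s) = (\<sigma> h, c) # h"
        using c by (auto simp: Let_def edge_color_def \<pi>'_def)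
      with Suc.IH[of "Suc s" \<pi>'] Suc.prems show ?thesis by simp
    qed
    then show ?case
      using legal unfolding h_def[symmetric] legal_builder_def
      by (intro forces.move) auto
  qed
  from this[of t 0] show ?thesis by simp
qed

text \<open>
  The length of the history tells Builder how many rounds remain, so choosing any move that keeps
  the goal forced within that number is a strategy depending on the history alone.
\<close>

lemma forces_imp_strategy:
  assumes "forces Q t []"
  shows "\<exists>\<sigma>. legal_builder \<sigma> \<and> (\<forall>\<pi>. \<exists>s\<le>t. Q (play \<sigma> \<pi> s))"
proof -
  define good where "good h e \<longleftrightarrow> e \<in> edges complete_nat \<and>
    (\<forall>c. map_of h e \<in> {None, Some c} \<longrightarrow> forces Q (t - Suc (length h)) ((e, c) # h))" for h e
  \<comment> \<open>The edge \<open>{0, 1}\<close> only serves to keep the strategy legal at hopeless positions.\<close>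
  define \<sigma> where "\<sigma> h = (if \<exists>e. good h e then SOME e. good h e else {0, 1})" for h
  have good_\<sigma>: "good h (\<sigma> h)" if "good h e" for h e
    using that by (auto simp: \<sigma>_def intro: someI)
  have "legal_builder \<sigma>"
    unfolding legal_builder_def
  proof
    fix h
    show "\<sigma> h \<in> edges complete_nat"
    proof (cases "\<exists>e. good h e")
      case True
      then show ?thesis using good_\<sigma> good_def by blast
    next
      case False
      then have "\<sigma> h = {0, 1}" by (simp add: \<sigma>_def)
      moreover have "(0 :: nat) \<noteq> 1" by simp
      ultimately show ?thesis unfolding complete_nat_def graph.simps by blast
    qed
  qed
  moreover have "\<exists>s\<le>t. Q (play \<sigma> \<pi> s)" for \<pi>
  proof -
    have "(\<exists>s'\<le>s. Q (play \<sigma> \<pi> s')) \<or> forces Q (t - s) (play \<sigma> \<pi> s)" if "s \<le> t" for s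
      using that
    proof (induction s)
      case 0
      then show ?case using assms by simp
    next
      case (Suc s)
      define h where "h = play \<sigma> \<pi> s"
      consider (won) "\<exists>s'\<le>s. Q (play \<sigma> \<pi> s')" | (pending) "forces Q (t - s) h" "\<not> Q h"
        using Suc h_def by auto
      then show ?case
      proof cases
        case won
        then show ?thesis using le_SucI by blast
      next
        case pending
        from pending(1) obtain e where "good h e"
        proof cases
          case (move e t')
          then have "t' = t - Suc s" by simp
          with move show ?thesis by (intro that[of e]) (auto simp: good_def h_def)
        qed (use pending(2) in simp)
        then have "good h (\<sigma> h)" by (rule good_\<sigma>)
        moreover have "map_of h (\<sigma> h) \<in> {None, Some (edge_color \<pi> h (\<sigma> h))}"
          by (auto simp: edge_color_def split: option.splits)
        ultimately have "forces Q (t - Suc s) ((\<sigma> h, edge_color \<pi> h (\<sigma> h)) # h)"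
          by (auto simp: good_def h_def)
        then show ?thesis by (simp add: h_def Let_def)
      qed
    qed
    from this[of t] show ?thesis by (auto elim: forces.cases)
  qed
  ultimately show ?thesis by blast
qed

lemma builder_wins_within_iff_forces:
  "builder_wins_within G H t \<longleftrightarrow> forces (\<lambda>h. has_copy Red G h \<or> has_copy Blue H h) t []"
proof -
  define W where "W h \<longleftrightarrow> has_copy Red G h \<or> has_copy Blue H h" for h
  have mono: "W h'" if "W h" "set h \<subseteq> set h'" for h h'
    using that has_copy_mono[of Red G h h'] has_copy_mono[of Blue H h h'] by (auto simp: W_def)
  have "forces W t []" if "legal_builder \<sigma>" "\<And>\<pi>. \<exists>s\<le>t. W (play \<sigma> \<pi> s)" for \<sigma>
    using that mono by (rule strategy_imp_forces)
  then have "(\<exists>\<sigma>. legal_builder \<sigma> \<and> (\<forall>\<pi>. \<exists>s\<le>t. W (play \<sigma> \<pi> s))) \<longleftrightarrow> forces W t []"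
    using forces_imp_strategy[of W t] by blast
  then show ?thesis
    by (simp add: builder_wins_within_def W_def[abs_def])
qed

section \<open>Combining strategies\<close>

lemma forces_le: "forces Q s h \<Longrightarrow> s \<le> t \<Longrightarrow> forces Q t h"
proof (induction arbitrary: t rule: forces.induct)
  case (move e h s)
  then obtain t' where "t = Suc t'" "s \<le> t'" by (cases t) auto
  with move show ?case by (auto intro: forces.move)
qed (rule forces.reached)

lemma forces_trans:
  assumes "forces Q s h" and "\<And>h. Q h \<Longrightarrow> forces R t h"
  shows "forces R (s + t) h"
  using assms(1)
proof induction
  case (reached h s)
  then show ?case using assms(2) forces_le le_add2 by blast
next
  case (move e h s)
  then show ?case by (auto intro: forces.move)
qed

lemma forces_mono: "forces Q t h \<Longrightarrow> (\<And>h. Q h \<Longrightarrow> R h) \<Longrightarrow> forces R t h"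
  using forces_trans[of Q t h R 0] by (simp add: forces.reached)

text \<open>
  Builder can ask for a prescribed list of edges in order; Painter's only influence is on
  their colors.
\<close>

lemma forces_present_edges:
  assumes "set es \<subseteq> edges complete_nat"
  shows "forces (\<lambda>h'. set h \<subseteq> set h' \<and> (\<forall>e\<in>set es. \<exists>c. (e, c) \<in> set h')) (length es) h"
  using assms
proof (induction es arbitrary: h)
  case Nil
  then show ?case by (auto intro: forces.reached)
next
  case (Cons e es)
  have "forces (\<lambda>h'. set h \<subseteq> set h' \<and> (\<forall>e\<in>set (e # es). \<exists>c. (e, c) \<in> set h'))
    (length es) ((e, c) # h)" for c
    by (rule forces_mono[OF Cons.IH]) (use Cons.prems in auto)
  then show ?case using Cons.prems by (auto intro: forces.move)
qed

definition relabel :: "(nat \<Rightarrow> nat) \<Rightarrow> history \<Rightarrow> history" where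
  "relabel g h = map (\<lambda>(e, c). (g ` e, c)) h"

lemma map_of_relabel: "inj g \<Longrightarrow> map_of (relabel g h) (g ` e) = map_of h e"
  by (induction h) (auto simp: relabel_def inj_image_eq_iff)

lemma image_edge: "inj g \<Longrightarrow> e \<in> edges complete_nat \<Longrightarrow> g ` e \<in> edges complete_nat"
proof -
  assume "inj g" "e \<in> edges complete_nat"
  then obtain u v where "g ` e = {g u, g v}" "g u \<noteq> g v"
    by (auto simp: complete_nat_def inj_eq)
  then show ?thesis by (auto simp: complete_nat_def)
qed

text \<open>
  A strategy for the empty board can be played on a copy of the vertex set, given by \<open>g\<close>, while
  the board already carries edges \<open>h0\<close> outside that copy: whether an edge of the copy has been
  colored, and how, depends on the copied game alone.
\<close>

lemma forces_relabel:
  assumes "forces Q t h" "inj g"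
    and fresh: "\<And>e. e \<in> edges complete_nat \<Longrightarrow> g ` e \<notin> fst ` set h0"
  shows "forces (\<lambda>h'. \<exists>h. Q h \<and> h' = relabel g h @ h0) t (relabel g h @ h0)"
  using assms(1)
proof induction
  case (reached h t)
  then show ?case by (auto intro: forces.reached)
next
  case (move e h t)
  have "map_of h0 (g ` e) = None"
    using fresh[OF move.hyps(1)] by (simp add: map_of_eq_None_iff)
  then have "map_of (relabel g h @ h0) (g ` e) = map_of h e"
    using map_of_relabel[OF assms(2)] by (simp add: map_add_def split: option.split)
  moreover have "relabel g ((e, c) # h) @ h0 = (g ` e, c) # relabel g h @ h0" for c
    by (simp add: relabel_def)
  ultimately show ?case
    using move.IH image_edge[OF assms(2) move.hyps(1)] by (auto intro!: forces.move)
qed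

section \<open>Monochromatic paths\<close>

lemma has_copy_path_graph:
  "has_copy c (path_graph n) h \<longleftrightarrow>
    (\<exists>f. inj_on f {..<n} \<and> (\<forall>i. Suc i < n \<longrightarrow> ({f i, f (Suc i)}, c) \<in> set h))"
proof -
  have "(\<forall>e\<in>edges (path_graph n). (f ` e, c) \<in> set h) \<longleftrightarrow>
      (\<forall>i. Suc i < n \<longrightarrow> ({f i, f (Suc i)}, c) \<in> set h)" for f :: "nat \<Rightarrow> nat"
  proof
    assume *: "\<forall>e\<in>edges (path_graph n). (f ` e, c) \<in> set h"
    show "\<forall>i. Suc i < n \<longrightarrow> ({f i, f (Suc i)}, c) \<in> set h"
    proof (intro allI impI)
      fix i assume "Suc i < n"
      then have "{i, Suc i} \<in> edges (path_graph n)" by (auto simp: path_graph_def)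
      with * have "(f ` {i, Suc i}, c) \<in> set h" by blast
      then show "({f i, f (Suc i)}, c) \<in> set h" by simp
    qed
  qed (auto simp: path_graph_def)
  then show ?thesis
    by (simp add: has_copy_def complete_nat_def) (simp add: path_graph_def)
qed

lemma has_copy_path_le:
  "has_copy c (path_graph n) h \<Longrightarrow> m \<le> n \<Longrightarrow> has_copy c (path_graph m) h"
  unfolding has_copy_path_graph
  by (meson inj_on_subset lessThan_subset_iff less_le_trans)

lemma has_copy_path_append:
  assumes p: "inj_on p {..<a}" "\<And>i. Suc i < a \<Longrightarrow> ({p i, p (Suc i)}, c) \<in> set h"
    and q: "inj_on q {..<b}" "\<And>i. Suc i < b \<Longrightarrow> ({q i, q (Suc i)}, c) \<in> set h"
    and disj: "p ` {..<a} \<inter> q ` {..<b} = {}"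
    and link: "({p (a - 1), q 0}, c) \<in> set h"
  shows "has_copy c (path_graph (a + b)) h"
proof -
  define f where "f i = (if i < a then p i else q (i - a))" for i
  have "inj_on f {..<a + b}"
  proof (rule inj_onI)
    fix x y
    assume *: "x \<in> {..<a + b}" "y \<in> {..<a + b}" "f x = f y"
    have neq: "p i \<noteq> q j" if "i < a" "j < b" for i j
      using disj that by blast
    show "x = y"
    proof (cases "x < a"; cases "y < a")
      assume "x < a" "y < a"
      with * p(1) show ?thesis by (auto simp: f_def inj_on_def)
    next
      assume "x < a" "\<not> y < a"
      with * neq[of x "y - a"] show ?thesis by (auto simp: f_def)
    next
      assume "\<not> x < a" "y < a"
      with * neq[of y "x - a", symmetric] show ?thesis by (auto simp: f_def split: if_splits)
    next
      assume xy: "\<not> x < a" "\<not> y < a"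
      with * have "x - a = y - a"
        by - (rule inj_onD[OF q(1)], auto simp: f_def)
      with xy show ?thesis by simp
    qed
  qed
  moreover have "({f i, f (Suc i)}, c) \<in> set h" if "Suc i < a + b" for i
  proof -
    consider "Suc i < a" | "Suc i = a" | "a \<le> i" by linarith
    then show ?thesis
    proof cases
      case 1
      then show ?thesis using p(2) by (simp add: f_def)
    next
      case 2
      then show ?thesis using link by (auto simp: f_def)
    next
      case 3
      then have "f (Suc i) = q (Suc (i - a))" by (simp add: f_def Suc_diff_le)
      then show ?thesis using 3 that q(2)[of "i - a"] by (simp add: f_def)
    qed
  qed
  ultimately show ?thesis unfolding has_copy_path_graph by blast
qed

text \<open>The path alternates between the two sides \<open>u\<close> and \<open>v\<close>.\<close>

lemma has_copy_path_bipartite: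
  assumes u: "inj_on u {..<k}" and v: "inj_on v {..<k}"
    and disj: "u ` {..<k} \<inter> v ` {..<k} = {}"
    and mono: "\<And>i j. i < k \<Longrightarrow> j < k \<Longrightarrow> ({u i, v j}, c) \<in> set h"
  shows "has_copy c (path_graph (2 * k)) h"
proof -
  define f where "f i = (if even i then u (i div 2) else v (i div 2))" for i
  have "inj_on f {..<2 * k}"
  proof (rule inj_onI)
    fix x y
    assume *: "x \<in> {..<2 * k}" "y \<in> {..<2 * k}" "f x = f y"
    then have xy: "x div 2 < k" "y div 2 < k" by auto
    have neq: "u i \<noteq> v j" if "i < k" "j < k" for i j
      using disj that by blast
    have "even x = even y"
      using * neq[OF xy] neq[OF xy(2,1)] by (auto simp: f_def split: if_splits)
    moreover from this have "x div 2 = y div 2"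
      using * xy u v by (auto simp: f_def inj_on_def split: if_splits)
    ultimately show "x = y" by (metis even_two_times_div_two odd_two_times_div_two_succ)
  qed
  moreover have "({f i, f (Suc i)}, c) \<in> set h" if "Suc i < 2 * k" for i
  proof (cases "even i")
    case True
    then show ?thesis using mono[of "i div 2" "i div 2"] that by (auto simp: f_def)
  next
    case False
    then obtain m where i: "i = 2 * m + 1" by (elim oddE)
    then show ?thesis using mono[of "Suc m" m] that by (simp add: f_def insert_commute)
  qed
  ultimately show ?thesis unfolding has_copy_path_graph by blast
qed

lemma has_copy_path_relabel:
  assumes "has_copy c (path_graph n) h" "inj g" "set (relabel g h) \<subseteq> set h'"
  shows "has_copy c (path_graph n) h'"
proof -
  obtain f where f: "inj_on f {..<n}" "\<And>i. Suc i < n \<Longrightarrow> ({f i, f (Suc i)}, c) \<in> set h"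
    using assms(1) unfolding has_copy_path_graph by blast
  have "({g (f i), g (f (Suc i))}, c) \<in> set h'" if "Suc i < n" for i
    using f(2)[OF that] assms(3) by (force simp: relabel_def)
  moreover have "inj_on (g \<circ> f) {..<n}"
    using f(1) assms(2) by (auto intro: comp_inj_on inj_on_subset)
  ultimately show ?thesis
    unfolding has_copy_path_graph by (intro exI[of _ "g \<circ> f"]) simp
qed

section \<open>Joining two blue paths\<close>

abbreviation path_win :: "nat \<Rightarrow> nat \<Rightarrow> history \<Rightarrow> bool" where
  "path_win k n h \<equiv> has_copy Red (path_graph k) h \<or> has_copy Blue (path_graph n) h"

text \<open>
  Builder plays the edges between the last \<open>k\<close> vertices of one blue path and the first \<open>k\<close> of
  the other. A blue edge among them links two long pieces; otherwise they are all red and contain a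
  red path.
\<close>

lemma forces_join_paths:
  assumes p: "inj_on p {..<a + 2 * k}"
      "\<And>i. Suc i < a + 2 * k \<Longrightarrow> ({p i, p (Suc i)}, Blue) \<in> set h"
    and q: "inj_on q {..<b + 2 * k}"
      "\<And>i. Suc i < b + 2 * k \<Longrightarrow> ({q i, q (Suc i)}, Blue) \<in> set h"
    and disj: "\<And>i j. p i \<noteq> q j"
  shows "forces (path_win k (a + b + 2 * k)) (k * k) h"
proof -
  \<comment> \<open>\<open>u\<close> runs through the first path from its end backwards.\<close>
  define u where "u i = p (a + 2 * k - 1 - i)" for i
  define es where "es = map (\<lambda>(i, j). {u i, q j}) (List.product [0..<k] [0..<k])"
  have "set es \<subseteq> edges complete_nat"
    using disj by (auto simp: es_def complete_nat_def u_def)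
  then have "forces (\<lambda>h'. set h \<subseteq> set h' \<and> (\<forall>e\<in>set es. \<exists>c. (e, c) \<in> set h')) (length es) h"
    by (rule forces_present_edges)
  moreover have "path_win k (a + b + 2 * k) h'"
    if sub: "set h \<subseteq> set h'" and es: "\<forall>e\<in>set es. \<exists>c. (e, c) \<in> set h'" for h'
  proof (cases "\<exists>i<k. \<exists>j<k. ({u i, q j}, Blue) \<in> set h'")
    case True
    then obtain i j where ij: "i < k" "j < k" "({u i, q j}, Blue) \<in> set h'" by blast
    have "has_copy Blue (path_graph ((a + 2 * k - i) + (b + 2 * k - j))) h'"
    proof (rule has_copy_path_append[where p = p and q = "\<lambda>x. q (j + x)"])
      show "inj_on p {..<a + 2 * k - i}"
        using p(1) by (rule inj_on_subset) auto
      show "inj_on (\<lambda>x. q (j + x)) {..<b + 2 * k - j}"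
      proof (rule inj_onI)
        fix x y
        assume "x \<in> {..<b + 2 * k - j}" "y \<in> {..<b + 2 * k - j}" "q (j + x) = q (j + y)"
        then have "j + x = j + y" by - (rule inj_onD[OF q(1)], auto)
        then show "x = y" by simp
      qed
      show "({p (a + 2 * k - i - 1), q (j + 0)}, Blue) \<in> set h'"
        using ij by (simp add: u_def)
    qed (use p(2) q(2) sub disj in auto)
    then have "has_copy Blue (path_graph (a + b + 2 * k)) h'"
      by (rule has_copy_path_le) (use ij in simp)
    then show ?thesis ..
  next
    case False
    have "({u i, q j}, Red) \<in> set h'" if "i < k" "j < k" for i j
    proof -
      have "{u i, q j} \<in> set es" using that by (force simp: es_def)
      with es obtain c where "({u i, q j}, c) \<in> set h'" by blast
      with False that show ?thesis by (cases c) auto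
    qed
    moreover have "inj_on u {..<k}"
    proof (rule inj_onI)
      fix x y
      assume xy: "x \<in> {..<k}" "y \<in> {..<k}" "u x = u y"
      then have "a + 2 * k - 1 - x = a + 2 * k - 1 - y"
        by - (rule inj_onD[OF p(1)], auto simp: u_def)
      with xy show "x = y" by auto
    qed
    moreover have "inj_on q {..<k}" using q(1) by (rule inj_on_subset) auto
    moreover have "u ` {..<k} \<inter> q ` {..<k} = {}" using disj by (auto simp: u_def)
    ultimately have "has_copy Red (path_graph (2 * k)) h'"
      by (intro has_copy_path_bipartite) auto
    then have "has_copy Red (path_graph k) h'" by (rule has_copy_path_le) simp
    then show ?thesis ..
  qed
  ultimately have "forces (path_win k (a + b + 2 * k)) (length es) h"
    by (rule forces_mono) simp_all
  then show ?thesis by (simp add: es_def)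
qed

text \<open>
  The two games are kept apart by playing one on the even and the other on the odd numbers. The
  path lengths carry a surplus of \<open>2 * k\<close> so that the vertices cut off in joining leave the sum
  \<open>a + b\<close> intact and the bound becomes additive in \<open>a\<close> and \<open>b\<close>.
\<close>

lemma forces_path_add:
  assumes r: "forces (path_win k (a + 2 * k)) r []" and s: "forces (path_win k (b + 2 * k)) s []"
  shows "forces (path_win k (a + b + 2 * k)) (r + s + k * k) []"
proof -
  define g0 g1 :: "nat \<Rightarrow> nat" where "g0 = (\<lambda>x. 2 * x)" and "g1 = (\<lambda>x. 2 * x + 1)"
  have inj: "inj g0" "inj g1" by (auto simp: g0_def g1_def inj_def)
  have neq: "g0 x \<noteq> g1 y" for x y unfolding g0_def g1_def by presburger
  have first: "forces (\<lambda>h'. \<exists>h1. path_win k (a + 2 * k) h1 \<and> h' = relabel g0 h1) r []"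
    using forces_relabel[OF r inj(1), of "[]"] by (simp add: relabel_def)
  have second: "forces (\<lambda>h'. \<exists>h2. path_win k (b + 2 * k) h2 \<and> h' = relabel g1 h2 @ relabel g0 h1)
      s (relabel g0 h1)" for h1
  proof -
    have "g1 ` e \<notin> fst ` set (relabel g0 h1)" if e: "e \<in> edges complete_nat" for e
    proof
      assume "g1 ` e \<in> fst ` set (relabel g0 h1)"
      then obtain e' where "g1 ` e = g0 ` e'" by (auto simp: relabel_def)
      moreover obtain x where "x \<in> e" using e by (auto simp: complete_nat_def)
      ultimately show False using neq by (metis imageE imageI)
    qed
    from forces_relabel[OF s inj(2) this] show ?thesis by (simp add: relabel_def)
  qed
  have join: "forces (path_win k (a + b + 2 * k)) (k * k) (relabel g1 h2 @ relabel g0 h1)"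
    if h1: "path_win k (a + 2 * k) h1" and h2: "path_win k (b + 2 * k) h2" for h1 h2
  proof -
    let ?h = "relabel g1 h2 @ relabel g0 h1"
    consider "has_copy Red (path_graph k) h1" | "has_copy Red (path_graph k) h2"
      | (blue) "has_copy Blue (path_graph (a + 2 * k)) h1" "has_copy Blue (path_graph (b + 2 * k)) h2"
      using h1 h2 by blast
    then show ?thesis
    proof cases
      case 1
      then have "has_copy Red (path_graph k) ?h" by (rule has_copy_path_relabel[OF _ inj(1)]) auto
      then show ?thesis by (blast intro: forces.reached)
    next
      case 2
      then have "has_copy Red (path_graph k) ?h" by (rule has_copy_path_relabel[OF _ inj(2)]) auto
      then show ?thesis by (blast intro: forces.reached)
    next
      case blue
      obtain p where p: "inj_on p {..<a + 2 * k}"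
          "\<And>i. Suc i < a + 2 * k \<Longrightarrow> ({p i, p (Suc i)}, Blue) \<in> set h1"
        using blue(1) unfolding has_copy_path_graph by blast
      obtain q where q: "inj_on q {..<b + 2 * k}"
          "\<And>i. Suc i < b + 2 * k \<Longrightarrow> ({q i, q (Suc i)}, Blue) \<in> set h2"
        using blue(2) unfolding has_copy_path_graph by blast
      show ?thesis
      proof (rule forces_join_paths[where p = "g0 \<circ> p" and q = "g1 \<circ> q"])
        show "inj_on (g0 \<circ> p) {..<a + 2 * k}" "inj_on (g1 \<circ> q) {..<b + 2 * k}"
          using p(1) q(1) inj by (auto intro: comp_inj_on inj_on_subset)
        show "({(g0 \<circ> p) i, (g0 \<circ> p) (Suc i)}, Blue) \<in> set ?h" if "Suc i < a + 2 * k" for i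
          using p(2)[OF that] by (force simp: relabel_def)
        show "({(g1 \<circ> q) i, (g1 \<circ> q) (Suc i)}, Blue) \<in> set ?h" if "Suc i < b + 2 * k" for i
          using q(2)[OF that] by (force simp: relabel_def)
      qed (simp add: neq)
    qed
  qed
  have continue: "forces (path_win k (a + b + 2 * k)) (s + k * k) (relabel g0 h1)"
    if h1: "path_win k (a + 2 * k) h1" for h1
  proof (rule forces_trans[OF second])
    fix h assume "\<exists>h2. path_win k (b + 2 * k) h2 \<and> h = relabel g1 h2 @ relabel g0 h1"
    then obtain h2 where "path_win k (b + 2 * k) h2" "h = relabel g1 h2 @ relabel g0 h1"
      by (elim exE conjE)
    then show "forces (path_win k (a + b + 2 * k)) (k * k) h" using join[OF h1] by simp
  qed
  have "forces (path_win k (a + b + 2 * k)) (r + (s + k * k)) []"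
  proof (rule forces_trans[OF first])
    fix h assume "\<exists>h1. path_win k (a + 2 * k) h1 \<and> h = relabel g0 h1"
    then obtain h1 where "path_win k (a + 2 * k) h1" "h = relabel g0 h1"
      by (elim exE conjE)
    then show "forces (path_win k (a + b + 2 * k)) (s + k * k) h" using continue by simp
  qed
  then show ?thesis by (simp only: add.assoc)
qed

section \<open>Finiteness\<close>

lemma has_copy_path_clique:
  assumes "finite R" and mono: "\<And>x y. x \<in> R \<Longrightarrow> y \<in> R \<Longrightarrow> x \<noteq> y \<Longrightarrow> ({x, y}, c) \<in> set h"
  shows "has_copy c (path_graph (card R)) h"
proof -
  obtain f where f: "bij_betw f {0..<card R} R"
    using ex_bij_betw_nat_finite[OF assms(1)] ..
  have inj: "inj_on f {..<card R}"
    using f by (simp add: bij_betw_def atLeast0LessThan)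
  have "({f i, f (Suc i)}, c) \<in> set h" if "Suc i < card R" for i
  proof (rule mono)
    show "f i \<in> R" "f (Suc i) \<in> R" using that by (intro bij_betwE[OF f, rule_format]; simp)+
    show "f i \<noteq> f (Suc i)" using that inj_onD[OF inj, of i "Suc i"] by auto
  qed
  with inj show ?thesis
    unfolding has_copy_path_graph by (intro exI[of _ f]) simp
qed

text \<open>
  Builder plays all edges of a complete graph that is large enough for Ramsey's theorem; a
  monochromatic clique contains a path on all its vertices. This makes the minimum in
  \<^const>\<open>online_ramsey\<close> meaningful.
\<close>

lemma builder_wins_path_ex: "\<exists>t. builder_wins_within (path_graph k) (path_graph n) t"
proof -
  obtain r where ramsey: "\<forall>(V :: nat set) E. finite V \<and> r \<le> card V \<longrightarrow>
      (\<exists>R\<subseteq>V. card R = k \<and> clique R E \<or> card R = n \<and> indep R E)"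
    using ramsey2[where 'a = nat, of k n] by (elim exE conjE)
  have r: "\<exists>R\<subseteq>{..<r}. card R = k \<and> clique R E \<or> card R = n \<and> indep R E" for E
    by (rule ramsey[rule_format]) simp
  define K where "K = {e. e \<subseteq> {..<r} \<and> card e = 2}"
  have "finite K" by (rule finite_subset[of K "Pow {..<r}"]) (auto simp: K_def)
  then obtain es where es: "set es = K" using finite_list by blast
  have "set es \<subseteq> edges complete_nat"
    unfolding es by (auto simp: K_def complete_nat_def card_2_iff)
  then have "forces (\<lambda>h. set [] \<subseteq> set h \<and> (\<forall>e\<in>K. \<exists>c. (e, c) \<in> set h)) (length es) []"
    unfolding es[symmetric] by (rule forces_present_edges)
  then have "forces (path_win k n) (length es) []"
  proof (rule forces_mono)
    fix h :: history
    assume h: "set [] \<subseteq> set h \<and> (\<forall>e\<in>K. \<exists>c. (e, c) \<in> set h)"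
    obtain R where R: "R \<subseteq> {..<r}"
      "card R = k \<and> clique R {e. (e, Red) \<in> set h} \<or> card R = n \<and> indep R {e. (e, Red) \<in> set h}"
      using r[of "{e. (e, Red) \<in> set h}"] by blast
    have "finite R" using R(1) by (rule finite_subset) simp
    have blue: "({x, y}, Blue) \<in> set h"
      if "x \<in> R" "y \<in> R" "x \<noteq> y" "({x, y}, Red) \<notin> set h" for x y
    proof -
      have "{x, y} \<in> K" using that R(1) by (auto simp: K_def)
      with h obtain c where "({x, y}, c) \<in> set h" by blast
      with that show ?thesis by (cases c) auto
    qed
    from R(2) show "path_win k n h"
    proof (elim disjE conjE)
      assume "card R = k" "clique R {e. (e, Red) \<in> set h}"
      then have "has_copy Red (path_graph k) h"
        using has_copy_path_clique[OF \<open>finite R\<close>, of Red h] by (simp add: clique_def)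
      then show ?thesis ..
    next
      assume "card R = n" "indep R {e. (e, Red) \<in> set h}"
      then have "has_copy Blue (path_graph n) h"
        using has_copy_path_clique[OF \<open>finite R\<close>, of Blue h] blue by (simp add: indep_def)
      then show ?thesis ..
    qed
  qed
  then show ?thesis by (auto simp: builder_wins_within_iff_forces)
qed

section \<open>The limit\<close>

lemma online_ramsey_path_add:
  fixes k a b :: nat
  defines "r \<equiv> \<lambda>n. online_ramsey (path_graph k) (path_graph (n + 2 * k))"
  shows "r (a + b) \<le> r a + r b + k * k"
proof -
  let ?wins = "\<lambda>n. builder_wins_within (path_graph k) (path_graph (n + 2 * k))"
  have r: "r n = (LEAST t. ?wins n t)" for n
    by (simp add: r_def online_ramsey_def)
  have "?wins n (r n)" for n
    unfolding r by (rule LeastI_ex[of "?wins n"], rule builder_wins_path_ex)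
  then have "forces (path_win k (n + 2 * k)) (r n) []" for n
    by (simp only: builder_wins_within_iff_forces)
  from forces_path_add[OF this this] have "?wins (a + b) (r a + r b + k * k)"
    by (simp only: builder_wins_within_iff_forces)
  then show ?thesis
    unfolding r[of "a + b"] by (rule Least_le[of "?wins (a + b)"])
qed

text \<open>
  Fekete's lemma for nonnegative sequences: the limit is the infimum \<open>L\<close> of all \<open>s n / n\<close>.
  If \<open>s m / m\<close> is close to \<open>L\<close>, division of \<open>n\<close> by \<open>m\<close> with remainder bounds \<open>s n / n\<close> by
  \<open>s m / m\<close> plus a bounded multiple of \<open>1 / n\<close>.
\<close>

lemma fekete:
  fixes s :: "nat \<Rightarrow> real"
  assumes nonneg: "\<And>n. s n \<ge> 0" and subadd: "\<And>m n. s (m + n) \<le> s m + s n"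
  shows "\<exists>L. (\<lambda>n. s n / n) \<longlonglongrightarrow> L"
proof -
  define L where "L = (INF n\<in>{1..}. s n / n)"
  have bdd: "bdd_below ((\<lambda>n. s n / n) ` {1..})"
    using nonneg by (intro bdd_belowI2[where m = 0]) simp
  have mult: "s (q * m + r) \<le> q * s m + s r" for q m r
  proof (induction q)
    case (Suc q)
    have "s (Suc q * m + r) \<le> s m + s (q * m + r)"
      using subadd[of m "q * m + r"] by (simp add: add.assoc)
    with Suc show ?case by (simp add: algebra_simps)
  qed simp
  have "\<forall>\<^sub>F n in sequentially. \<bar>s n / n - L\<bar> < e" if e: "e > 0" for e
  proof -
    have "\<exists>m\<in>{1..}. s m / m < L + e / 2"
      using e by (subst cINF_less_iff[OF _ bdd, symmetric]) (auto simp: L_def)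
    then obtain m where m: "m \<ge> 1" "s m / m < L + e / 2" by auto
    define C where "C = (\<Sum>r<m. s r)"
    have C: "s r \<le> C" if "r < m" for r
      unfolding C_def using that nonneg by (intro member_le_sum) auto
    have upper: "s n / n \<le> s m / m + C / n" if n: "n \<ge> 1" for n
    proof -
      have "s n = s (n div m * m + n mod m)" by simp
      also have "\<dots> \<le> (n div m) * s m + s (n mod m)" by (rule mult)
      also have "\<dots> \<le> (n / m) * s m + C"
      proof (rule add_mono)
        show "(n div m) * s m \<le> (n / m) * s m"
          using nonneg by (intro mult_right_mono of_nat_div_le_of_nat)
        show "s (n mod m) \<le> C" using m(1) by (intro C) simp
      qed
      finally have "s n / n \<le> ((n / m) * s m + C) / n"
        by (rule divide_right_mono) simp
      also have "\<dots> = s m / m + C / n"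
        using n by (simp add: add_divide_distrib)
      finally show ?thesis .
    qed
    have lower: "L \<le> s n / n" if "n \<ge> 1" for n
      unfolding L_def using that by (intro cINF_lower[OF bdd]) simp
    have "(\<lambda>n. C / real n) \<longlonglongrightarrow> 0" by (rule lim_const_over_n)
    then have "\<forall>\<^sub>F n in sequentially. C / n < e / 2"
      by (rule order_tendstoD) (use e in simp)
    then show ?thesis
      using eventually_ge_at_top[of 1]
    proof eventually_elim
      case (elim n)
      have "s n / n < L + e" using upper[OF elim(2)] elim(1) m(2) by linarith
      with lower[OF elim(2)] e show ?case by linarith
    qed
  qed
  then show ?thesis
    unfolding tendsto_iff dist_real_def by blast
qed

theorem theorem1p1:
  fixes k :: nat
  assumes "k \<ge> 1"
  shows "\<exists>L::real.
    (\<lambda>n. real (online_ramsey (path_graph k) (path_graph n)) / real n) \<longlonglongrightarrow> L"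
proof -
  let ?r = "\<lambda>n. real (online_ramsey (path_graph k) (path_graph n))"
  define s where "s n = ?r (n + 2 * k) + k * k" for n
  have "s (m + n) \<le> s m + s n" for m n
    using online_ramsey_path_add[of k m n] by (simp add: s_def flip: of_nat_add of_nat_mult)
  then obtain L where L: "(\<lambda>n. s n / n) \<longlonglongrightarrow> L"
    using fekete[of s] by (auto simp: s_def)
  have "(\<lambda>n. (s n / n - (k * k) / n) / (1 + (2 * k) / n)) \<longlonglongrightarrow> (L - 0) / (1 + 0)"
    by (intro tendsto_intros L lim_const_over_n) simp
  moreover have "\<forall>\<^sub>F n in sequentially.
      (s n / n - (k * k) / n) / (1 + (2 * k) / n) = ?r (n + 2 * k) / real (n + 2 * k)"
    using eventually_gt_at_top[of 0]
    by eventually_elim (simp add: s_def field_simps)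
  ultimately have "(\<lambda>n. ?r (n + 2 * k) / real (n + 2 * k)) \<longlonglongrightarrow> (L - 0) / (1 + 0)"
    by (rule Lim_transform_eventually)
  then have "(\<lambda>n. ?r n / real n) \<longlonglongrightarrow> (L - 0) / (1 + 0)"
    by (rule LIMSEQ_offset[where f = "\<lambda>n. ?r n / real n" and k = "2 * k"])
  then show ?thesis ..
qed

end
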